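(* Let $r\ge1$ be an integer, and let $\lambda_r,\lambda'_r\in\mathbb{C}\setminus\{0,1\}$ with $\lambda_r\ne\lambda'_r$. (1) $P^d_n(\lambda_r;r)=P_n$ for $0\le n\le r$, and $P^d_n(\lambda_r;r)(x)=P_n(x)+\frac{1-\lambda_r}{4}P_{r-1}(x)P_{n-r-1}(x)$ for $n\ge r+1$. For $n\ge r+1$, consider the three polynomials $P^d_n(\lambda_r;r)$, $P^d_n(\lambda'_r;r)$, $P_n$, and their interception points and common zeros. Then: (2) The three polynomials intersect each other at the zeros of $P_{r-1}$ and at the zeros of $P_{n-r-1}$. (3) $\xi$ is a double interception point if and only if $\xi$ is a common zero of $P_{r-1}$ and $P_{n-r-1}$. (4) For $n=r(i+1)$ with $i\ge1$, $r\ge1$, all zeros of $P_{r-1}$ are double interception points, and the number of distinct interception points is $n-r-1$. (5) If $r$ is even: if $n$ is even, then the origin is a double interception point; if $n$ is odd, then the origin is a simple interception point. If $r$ is odd: if $n$ is even, then the origin is not an interception point; if $n$ is odd, then the origin is a simple interception point. (6) $\xi$ is a common zero of the three polynomials if and only if $\xi$ is a common zero of $P_n$ and $P_{r-1}$ or $\xi$ is a common zero of $P_n$ and $P_{n-r-1}$. (7) For $n=jr-1$ with $j\ge2$, $r\ge1$, all zeros of $P_{r-1}$ are common zeros of the three polynomials. (8) $\xi$ is a double common zero of the three polynomials if and only if $\xi$ is a common zero of $P_{r-1}$, $P_n$ and $P_{n-r-1}$. (9) It is not possible that all zeros of $P_{r-1}$ are simultaneously double common zeros of the three polynomials. (10)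 If $n$ is odd, then the origin is a simple common zero of the three polynomials. If $n$ is even, then the origin is not a common zero of the three polynomials.
   Context: $\{P_n\}_{n\ge0}$ denotes the monic Chebyshev polynomials of the second kind: $P_0=1$, $P_1=x$, $P_{n+2}(x)=xP_{n+1}(x)-\frac14P_n(x)$ for $n\ge 0$. For an integer $r\ge 1$ and $\lambda_r\in\mathbb{C}\setminus\{0,1\}$, the $r$th-perturbed sequence by dilatation $\{P^d_n(\lambda_r;r)\}_{n\ge 0}$ is the monic sequence with $P^d_0=1$, $P^d_1(x)=x$, $P^d_{n+2}(x)=xP^d_{n+1}(x)-\gamma_{n+1}P^d_n(x)$ for $n\ge 0$, where $\gamma_r=\lambda_r/4$ and $\gamma_{n+1}=1/4$ for $n\ge 0$, $n\ne r-1$. An interception point of several polynomials is a point $\xi$ at which they all take the same value; it is double if moreover all their first derivatives agree at $\xi$ (i.e. each pairwise difference and its derivative vanish at $\xi$), and simple otherwise. A common zero is a point where all the polynomials vanish; a common zero is called double if it is also a double interception point and simple otherwise (this does not refer to the multiplicity as a zero of the individual polynomials).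
   Formalization: Item (9) is stated for r ≥ 2 only: for r = 1 the polynomial P_{r-1} = P_0 = 1 has no zeros, so all its zeros are vacuously double common zeros and (9) fails as written. *)

theory Defs
  imports Complex_Main "HOL-Computational_Algebra.Polynomial"
begin

text \<open>Monic Chebyshev polynomials of the second kind; in terms of the usual normalisation
  this is \<open>U\<^sub>n / 2 ^ n\<close>.\<close>

fun chebP :: "nat \<Rightarrow> complex poly" where
  "chebP 0 = 1"
| "chebP (Suc 0) = [:0, 1:]"
| "chebP (Suc (Suc n)) = [:0, 1:] * chebP (Suc n) - smult (1/4) (chebP n)"

text \<open>The coefficient \<open>\<gamma>\<^sub>k\<close> is only meaningful for \<open>k \<ge> 1\<close>.\<close>

definition dil_coeff :: "nat \<Rightarrow> complex \<Rightarrow> nat \<Rightarrow> complex" where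
  "dil_coeff r lam k = (if k = r then lam / 4 else 1 / 4)"

fun chebPd :: "nat \<Rightarrow> complex \<Rightarrow> nat \<Rightarrow> complex poly" where
  "chebPd r lam 0 = 1"
| "chebPd r lam (Suc 0) = [:0, 1:]"
| "chebPd r lam (Suc (Suc n)) =
     [:0, 1:] * chebPd r lam (Suc n) - smult (dil_coeff r lam (Suc n)) (chebPd r lam n)"

definition interception_point :: "complex poly set \<Rightarrow> complex \<Rightarrow> bool" where
  "interception_point S \<xi> \<longleftrightarrow> (\<forall>p\<in>S. \<forall>q\<in>S. poly p \<xi> = poly q \<xi>)"

definition double_interception_point :: "complex poly set \<Rightarrow> complex \<Rightarrow> bool" where
  "double_interception_point S \<xi> \<longleftrightarrow> interception_point S \<xi> \<and>
     (\<forall>p\<in>S. \<forall>q\<in>S. poly (pderiv p) \<xi> = poly (pderiv q) \<xi>)"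

definition simple_interception_point :: "complex poly set \<Rightarrow> complex \<Rightarrow> bool" where
  "simple_interception_point S \<xi> \<longleftrightarrow> interception_point S \<xi> \<and> \<not> double_interception_point S \<xi>"

text \<open>A double common zero need not be a multiple root of the individual polynomials: their
  derivatives only have to agree there, not to vanish.\<close>

definition common_zero :: "complex poly set \<Rightarrow> complex \<Rightarrow> bool" where
  "common_zero S \<xi> \<longleftrightarrow> (\<forall>p\<in>S. poly p \<xi> = 0)"

definition double_common_zero :: "complex poly set \<Rightarrow> complex \<Rightarrow> bool" where
  "double_common_zero S \<xi> \<longleftrightarrow> common_zero S \<xi> \<and> double_interception_point S \<xi>"

definition simple_common_zero :: "complex poly set \<Rightarrow> complex \<Rightarrow> bool" where
  "simple_common_zero S \<xi> \<longleftrightarrow> common_zero S \<xi> \<and> \<not> double_common_zero S \<xi>"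

end

theory Submission
  imports Defs "HOL-Computational_Algebra.Fundamental_Theorem_Algebra"
begin

text \<open>The three polynomials are \<open>P\<close>, \<open>P + a F\<close> and \<open>P + b F\<close> with \<open>F = P\<^sub>r\<^sub>-\<^sub>1 P\<^sub>n\<^sub>-\<^sub>r\<^sub>-\<^sub>1\<close> and
  distinct nonzero \<open>a\<close>, \<open>b\<close>, so they meet exactly at the zeros of \<open>F\<close>, and doubly exactly at its
  multiple zeros. The zeros of each Chebyshev polynomial are simple, because
  \<open>(x\<^sup>2 - 1) P\<^sub>n'\<close> is a combination of \<open>P\<^sub>n\<close> and \<open>P\<^sub>n\<^sub>-\<^sub>1\<close>, and consecutive polynomials share no zero.
  The addition formula \<open>P\<^sub>n = P\<^sub>r P\<^sub>n\<^sub>-\<^sub>r - P\<^sub>r\<^sub>-\<^sub>1 P\<^sub>n\<^sub>-\<^sub>r\<^sub>-\<^sub>1 / 4\<close> shows that \<open>P\<^sub>r\<^sub>-\<^sub>1\<close> vanishes only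
  where \<open>P\<^sub>j\<^sub>r\<^sub>-\<^sub>1\<close> does, and that \<open>P\<^sub>r\<^sub>-\<^sub>1\<close>, \<open>P\<^sub>n\<close> and \<open>P\<^sub>n\<^sub>-\<^sub>r\<^sub>-\<^sub>1\<close> never vanish together: there
  is no double common zero at all, which settles (8) and (9).\<close>

section \<open>Degrees, zeros and the addition formula\<close>

lemma poly_chebP_Suc_Suc:
  "poly (chebP (Suc (Suc n))) x = x * poly (chebP (Suc n)) x - poly (chebP n) x / 4"
  by simp

lemma degree_lead_coeff_chebP: "degree (chebP n) = n \<and> lead_coeff (chebP n) = 1"
proof (induction n rule: chebP.induct)
  case (3 n)
  have nz: "chebP (Suc n) \<noteq> 0"
    using 3 by auto
  have deg: "degree (pCons 0 (chebP (Suc n))) = Suc (Suc n)"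
    using 3 nz by simp
  have rec: "chebP (Suc (Suc n)) = pCons 0 (chebP (Suc n)) + smult (- (1/4)) (chebP n)"
    by simp
  have less: "degree (smult (- (1/4)) (chebP n)) < degree (pCons 0 (chebP (Suc n)))"
    using 3 deg by simp
  have "degree (chebP (Suc (Suc n))) = Suc (Suc n)"
    unfolding rec using degree_add_eq_left[OF less] deg by simp
  moreover have "coeff (chebP (Suc (Suc n))) (Suc (Suc n)) = 1"
    unfolding rec coeff_add using 3 less deg
    by (metis add.right_neutral coeff_eq_0 coeff_pCons_Suc)
  ultimately show ?case
    by metis
qed simp_all

lemma degree_chebP [simp]: "degree (chebP n) = n"
  using degree_lead_coeff_chebP by blast

lemma chebP_nonzero [simp]: "chebP n \<noteq> 0"
  using degree_lead_coeff_chebP[of n] by auto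

lemma chebP_zero_exists:
  assumes "n > 0"
  shows "\<exists>\<xi>. poly (chebP n) \<xi> = 0"
  using assms by (intro alg_closed_imp_poly_has_root) simp

lemma poly_chebP_0_eq_0_iff: "poly (chebP n) 0 = 0 \<longleftrightarrow> odd n"
  by (induction n rule: chebP.induct) simp_all

lemma chebP_consecutive_no_common_zero:
  "\<not> (poly (chebP n) \<xi> = 0 \<and> poly (chebP (Suc n)) \<xi> = 0)"
  by (induction n) auto

text \<open>As functions of \<open>k\<close>, both sides satisfy the same three-term recurrence, so
  agreement at \<open>k = 0\<close> and \<open>k = 1\<close> suffices. The shifted indices avoid
  truncated subtraction.\<close>

lemma poly_chebP_add:
  "poly (chebP (m + Suc (Suc k))) x =
     poly (chebP (Suc m)) x * poly (chebP (Suc k)) x - poly (chebP m) x * poly (chebP k) x / 4"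
proof (induction k rule: chebP.induct)
  case (3 n)
  have "poly (chebP (m + Suc (Suc (Suc (Suc n))))) x =
    x * poly (chebP (m + Suc (Suc (Suc n)))) x - poly (chebP (m + Suc (Suc n))) x / 4"
    by simp
  then show ?case
    unfolding 3 poly_chebP_Suc_Suc by (simp add: field_simps)
qed (simp_all add: field_simps)

text \<open>With \<open>r = s + 1\<close> the index is \<open>(j + 1) * r - 1\<close>. Raising it by
  \<open>r\<close> through the addition formula gives one product containing \<open>chebP s\<close>
  and one containing the previous polynomial, and both vanish.\<close>

lemma chebP_zero_multiple:
  assumes "poly (chebP s) \<xi> = 0"
  shows "poly (chebP (j * Suc s + s)) \<xi> = 0"
proof (cases s)
  case 0
  with assms show ?thesis by simp
next
  case (Suc t)
  show ?thesis
  proof (induction j)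
    case (Suc j)
    have "Suc j * Suc s + s = (j * Suc s + s) + Suc (Suc t)"
      using \<open>s = Suc t\<close> by simp
    then have "poly (chebP (Suc j * Suc s + s)) \<xi> =
        poly (chebP (Suc (j * Suc s + s))) \<xi> * poly (chebP s) \<xi>
        - poly (chebP (j * Suc s + s)) \<xi> * poly (chebP t) \<xi> / 4"
      using poly_chebP_add \<open>s = Suc t\<close> by metis
    then show ?case
      using Suc assms by simp
  qed (simp add: assms)
qed

section \<open>Derivatives, simplicity and number of zeros\<close>

lemma poly_pderiv_chebP_Suc_Suc:
  "poly (pderiv (chebP (Suc (Suc n)))) x =
     poly (chebP (Suc n)) x + x * poly (pderiv (chebP (Suc n))) x - poly (pderiv (chebP n)) x / 4"
  by (simp add: pderiv_diff pderiv_smult pderiv_pCons)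

text \<open>The classical identity \<open>(x\<^sup>2 - 1) U\<^sub>n' = n x U\<^sub>n - (n + 1)
  U\<^sub>n\<^sub>-\<^sub>1\<close>, rescaled by \<open>U\<^sub>n = 2 ^ n P\<^sub>n\<close>; the
  rescaling produces the factor 1/2.\<close>

lemma poly_pderiv_chebP:
  "(x\<^sup>2 - 1) * poly (pderiv (chebP (Suc n))) x =
     of_nat (Suc n) * x * poly (chebP (Suc n)) x - of_nat (Suc (Suc n)) / 2 * poly (chebP n) x"
proof (induction n rule: chebP.induct)
  case (3 n)
  have "(x\<^sup>2 - 1) * poly (pderiv (chebP (Suc (Suc (Suc n))))) x =
      (x\<^sup>2 - 1) * poly (chebP (Suc (Suc n))) x
      + x * ((x\<^sup>2 - 1) * poly (pderiv (chebP (Suc (Suc n)))) x)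
      - (x\<^sup>2 - 1) * poly (pderiv (chebP (Suc n))) x / 4"
    unfolding poly_pderiv_chebP_Suc_Suc by (simp add: algebra_simps del: chebP.simps)
  also have "\<dots> = of_nat (Suc (Suc (Suc n))) * x * poly (chebP (Suc (Suc (Suc n)))) x
      - of_nat (Suc (Suc (Suc (Suc n)))) / 2 * poly (chebP (Suc (Suc n))) x"
    unfolding 3 poly_chebP_Suc_Suc by (simp add: field_simps power2_eq_square del: chebP.simps)
  finally show ?case .
qed (simp_all add: pderiv_diff pderiv_mult pderiv_smult pderiv_pCons field_simps power2_eq_square)

lemma chebP_zero_simple:
  assumes "poly (chebP n) \<xi> = 0"
  shows "poly (pderiv (chebP n)) \<xi> \<noteq> 0"
proof (cases n)
  case 0
  with assms show ?thesis by simp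
next
  case (Suc m)
  with assms have "poly (chebP m) \<xi> \<noteq> 0"
    using chebP_consecutive_no_common_zero by blast
  then have "(\<xi>\<^sup>2 - 1) * poly (pderiv (chebP n)) \<xi> \<noteq> 0"
    using assms poly_pderiv_chebP[of \<xi> m] unfolding Suc by (simp del: chebP.simps of_nat_Suc)
  then show ?thesis by auto
qed

text \<open>Over the complex numbers such a polynomial is a constant times distinct linear factors,
  one per root. This provides the count in (4).\<close>

lemma card_zeros_rsquarefree:
  fixes p :: "complex poly"
  assumes "rsquarefree p"
  shows "card {z. poly p z = 0} = degree p"
proof -
  have "p \<noteq> 0"
    using assms by (simp add: rsquarefree_def)
  then have "degree p = degree (\<Prod>z | poly p z = 0. [:-z, 1:])"
    using complex_poly_decompose_rsquarefree[OF assms] degree_smult_eq leading_coeff_neq_0 by metis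
  also have "\<dots> = card {z. poly p z = 0}"
    by (subst degree_prod_sum_eq) simp_all
  finally show ?thesis ..
qed

lemma card_zeros_chebP: "card {\<xi>. poly (chebP n) \<xi> = 0} = n"
  using chebP_zero_simple[of n] card_zeros_rsquarefree[of "chebP n"]
  by (auto simp: rsquarefree_roots)

section \<open>The perturbed sequence and its interception points\<close>

lemma chebPd_eq_chebP:
  assumes "n \<le> r"
  shows "chebPd r lam n = chebP n"
  using assms by (induction r lam n rule: chebPd.induct) (simp_all add: dil_coeff_def)

text \<open>Here \<open>r = s + 1\<close> and \<open>n = s + k + 2\<close>, so
  \<open>k = n - r - 1\<close>. The altered coefficient enters only in the step that produces index
  \<open>s + 2\<close>; afterwards both sides obey the unperturbed recurrence, so
  \<open>k = 0\<close> and \<open>k = 1\<close> are the base cases.\<close>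

lemma chebPd_eq_chebP_plus:
  "chebPd (Suc s) lam (Suc (Suc (s + k))) =
     chebP (Suc (Suc (s + k))) + smult ((1 - lam) / 4) (chebP s * chebP k)"
proof (induction k rule: chebP.induct)
  case 1
  show ?case
    by (simp add: dil_coeff_def chebPd_eq_chebP diff_divide_distrib smult_diff_left)
next
  case 2
  show ?case
    by (simp add: dil_coeff_def chebPd_eq_chebP diff_divide_distrib smult_diff_left algebra_simps)
next
  case (3 n)
  have "chebPd (Suc s) lam (Suc (Suc (s + Suc (Suc n)))) =
     [:0, 1:] * chebPd (Suc s) lam (Suc (Suc (s + Suc n)))
     - smult (1/4) (chebPd (Suc s) lam (Suc (Suc (s + n))))"
    by (simp add: dil_coeff_def)
  then show ?case
    unfolding 3 by (simp add: algebra_simps smult_add_right smult_diff_right)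
qed

text \<open>Up to sign the pairwise differences are \<open>F\<close> times \<open>a\<close>,
  \<open>b\<close> or \<open>a - b\<close>, all nonzero, so each pair already meets only at the
  zeros of \<open>F\<close>.\<close>

lemma interception_point_pencil:
  fixes P F :: "complex poly"
  assumes "a \<noteq> 0" "b \<noteq> 0" "a \<noteq> b"
    and "A = P + smult a F" "B = P + smult b F"
    and "S \<in> {{A, B, P}, {A, B}, {A, P}, {B, P}}"
  shows "interception_point S \<xi> \<longleftrightarrow> poly F \<xi> = 0"
  using assms by (auto simp: interception_point_def)

lemma double_interception_point_pencil:
  fixes P F :: "complex poly"
  assumes "a \<noteq> 0" "b \<noteq> 0" "a \<noteq> b"
    and "A = P + smult a F" "B = P + smult b F"
  shows "double_interception_point {A, B, P} \<xi> \<longleftrightarrow>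
    poly F \<xi> = 0 \<and> poly (pderiv F) \<xi> = 0"
  using assms by (auto simp: double_interception_point_def interception_point_def
    pderiv_add pderiv_smult)

lemma common_zero_pencil:
  fixes P F :: "complex poly"
  assumes "a \<noteq> 0" "A = P + smult a F" "B = P + smult b F"
  shows "common_zero {A, B, P} \<xi> \<longleftrightarrow> poly P \<xi> = 0 \<and> poly F \<xi> = 0"
  using assms by (auto simp: common_zero_def)

text \<open>At a zero of one factor, the product rule leaves the derivative of that factor times the
  other factor. Zeros being simple, the other factor must vanish too.\<close>

lemma double_zero_chebP_mult:
  "poly (chebP s * chebP k) \<xi> = 0 \<and> poly (pderiv (chebP s * chebP k)) \<xi> = 0 \<longleftrightarrow>
     poly (chebP s) \<xi> = 0 \<and> poly (chebP k) \<xi> = 0"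
  using chebP_zero_simple by (auto simp: pderiv_mult)

lemma no_common_zero_chebP_triple:
  "\<not> (poly (chebP s) \<xi> = 0 \<and> poly (chebP k) \<xi> = 0 \<and> poly (chebP (Suc (Suc (s + k)))) \<xi> = 0)"
proof
  assume z: "poly (chebP s) \<xi> = 0 \<and> poly (chebP k) \<xi> = 0 \<and> poly (chebP (Suc (Suc (s + k)))) \<xi> = 0"
  \<comment> \<open>The addition formula reduces the third polynomial to this product, and neither
    factor can vanish together with its predecessor.\<close>
  then have "poly (chebP (Suc s)) \<xi> * poly (chebP (Suc k)) \<xi> = 0"
    using poly_chebP_add[of s k \<xi>] by (simp del: chebP.simps)
  then show False
    using z chebP_consecutive_no_common_zero by auto
qed

theorem proposition5p9:
  fixes r :: nat and lam lam' :: complex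
  assumes "r \<ge> 1"
    and "lam \<noteq> 0" and "lam \<noteq> 1"
    and "lam' \<noteq> 0" and "lam' \<noteq> 1"
    and "lam \<noteq> lam'"
  shows
    "(\<forall>n\<le>r. chebPd r lam n = chebP n) \<and>
     (\<forall>n\<ge>r+1. chebPd r lam n =
        chebP n + smult ((1 - lam) / 4) (chebP (r - 1) * chebP (n - r - 1))) \<and>
     (\<forall>n\<ge>r+1. let A = chebPd r lam n; B = chebPd r lam' n; P = chebP n; T = {A, B, P} in
        (\<forall>S \<in> {T, {A, B}, {A, P}, {B, P}}.
           {\<xi>. interception_point S \<xi>} =
           {\<xi>. poly (chebP (r - 1)) \<xi> = 0} \<union> {\<xi>. poly (chebP (n - r - 1)) \<xi> = 0}) \<and>
        (\<forall>\<xi>. double_interception_point T \<xi> \<longleftrightarrow>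
           common_zero {chebP (r - 1), chebP (n - r - 1)} \<xi>) \<and>
        (\<forall>i\<ge>1. n = r * (i + 1) \<longrightarrow>
           (\<forall>\<xi>. poly (chebP (r - 1)) \<xi> = 0 \<longrightarrow> double_interception_point T \<xi>) \<and>
           finite {\<xi>. interception_point T \<xi>} \<and>
           card {\<xi>. interception_point T \<xi>} = n - r - 1) \<and>
        (even r \<and> even n \<longrightarrow> double_interception_point T 0) \<and>
        (even r \<and> odd n \<longrightarrow> simple_interception_point T 0) \<and>
        (odd r \<and> even n \<longrightarrow> \<not> interception_point T 0) \<and>
        (odd r \<and> odd n \<longrightarrow> simple_interception_point T 0) \<and>
        (\<forall>\<xi>. common_zero T \<xi> \<longleftrightarrow>
           common_zero {P, chebP (r - 1)} \<xi> \<or> common_zero {P, chebP (n - r - 1)} \<xi>) \<and>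
        (\<forall>j\<ge>2. n = j * r - 1 \<longrightarrow>
           (\<forall>\<xi>. poly (chebP (r - 1)) \<xi> = 0 \<longrightarrow> common_zero T \<xi>)) \<and>
        (\<forall>\<xi>. double_common_zero T \<xi> \<longleftrightarrow>
           common_zero {chebP (r - 1), P, chebP (n - r - 1)} \<xi>) \<and>
        (r \<ge> 2 \<longrightarrow>
           \<not> (\<forall>\<xi>. poly (chebP (r - 1)) \<xi> = 0 \<longrightarrow> double_common_zero T \<xi>)) \<and>
        (odd n \<longrightarrow> simple_common_zero T 0) \<and>
        (even n \<longrightarrow> \<not> common_zero T 0))"
proof -
  define a b where "a = (1 - lam) / 4" and "b = (1 - lam') / 4"
  have ab: "a \<noteq> 0" "b \<noteq> 0" "a \<noteq> b"
    using assms by (auto simp: a_def b_def)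
  obtain s where r: "r = Suc s"
    using \<open>r \<ge> 1\<close> by (cases r) auto
  have pert: "chebPd r l n =
      chebP n + smult ((1 - l) / 4) (chebP (r - 1) * chebP (n - r - 1))" if "n \<ge> r + 1" for l n
  proof -
    have "n = Suc (Suc (s + (n - r - 1)))"
      using that r by arith
    with chebPd_eq_chebP_plus[of s l "n - r - 1"] r show ?thesis
      by (metis diff_Suc_1)
  qed
  have main: "(\<forall>S \<in> {T, {A, B}, {A, P}, {B, P}}.
           {\<xi>. interception_point S \<xi>} =
           {\<xi>. poly (chebP (r - 1)) \<xi> = 0} \<union> {\<xi>. poly (chebP (n - r - 1)) \<xi> = 0}) \<and>
        (\<forall>\<xi>. double_interception_point T \<xi> \<longleftrightarrow>
           common_zero {chebP (r - 1), chebP (n - r - 1)} \<xi>) \<and>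
        (\<forall>i\<ge>1. n = r * (i + 1) \<longrightarrow>
           (\<forall>\<xi>. poly (chebP (r - 1)) \<xi> = 0 \<longrightarrow> double_interception_point T \<xi>) \<and>
           finite {\<xi>. interception_point T \<xi>} \<and>
           card {\<xi>. interception_point T \<xi>} = n - r - 1) \<and>
        (even r \<and> even n \<longrightarrow> double_interception_point T 0) \<and>
        (even r \<and> odd n \<longrightarrow> simple_interception_point T 0) \<and>
        (odd r \<and> even n \<longrightarrow> \<not> interception_point T 0) \<and>
        (odd r \<and> odd n \<longrightarrow> simple_interception_point T 0) \<and>
        (\<forall>\<xi>. common_zero T \<xi> \<longleftrightarrow>
           common_zero {P, chebP (r - 1)} \<xi> \<or> common_zero {P, chebP (n - r - 1)} \<xi>) \<and>
        (\<forall>j\<ge>2. n = j * r - 1 \<longrightarrow>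
           (\<forall>\<xi>. poly (chebP (r - 1)) \<xi> = 0 \<longrightarrow> common_zero T \<xi>)) \<and>
        (\<forall>\<xi>. double_common_zero T \<xi> \<longleftrightarrow>
           common_zero {chebP (r - 1), P, chebP (n - r - 1)} \<xi>) \<and>
        (r \<ge> 2 \<longrightarrow>
           \<not> (\<forall>\<xi>. poly (chebP (r - 1)) \<xi> = 0 \<longrightarrow> double_common_zero T \<xi>)) \<and>
        (odd n \<longrightarrow> simple_common_zero T 0) \<and>
        (even n \<longrightarrow> \<not> common_zero T 0)"
    if n: "n \<ge> r + 1"
      and defs: "A = chebPd r lam n" "B = chebPd r lam' n" "P = chebP n" "T = {A, B, P}"
    for n A B P T
  proof -
    define k where "k = n - r - 1"
    have nk: "n = Suc (Suc (s + k))" and rs: "r - 1 = s" and nrk: "n - r - 1 = k"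
      using n r by (simp_all add: k_def)
    let ?F = "chebP s * chebP k"
    have A: "A = P + smult a ?F" and B: "B = P + smult b ?F"
      using pert n rs nrk by (simp_all add: defs a_def b_def)
    have int: "interception_point S \<xi> \<longleftrightarrow> poly (chebP s) \<xi> = 0 \<or> poly (chebP k) \<xi> = 0"
      if "S \<in> {T, {A, B}, {A, P}, {B, P}}" for S \<xi>
      using interception_point_pencil[OF ab A B, of S \<xi>] that by (simp add: defs(4))
    have int_T: "interception_point T \<xi> \<longleftrightarrow> poly (chebP s) \<xi> = 0 \<or> poly (chebP k) \<xi> = 0" for \<xi>
      using int by simp
    have dbl: "double_interception_point T \<xi> \<longleftrightarrow> poly (chebP s) \<xi> = 0 \<and> poly (chebP k) \<xi> = 0" for \<xi>
      using double_interception_point_pencil[OF ab A B, of \<xi>] double_zero_chebP_mult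
      by (simp add: defs(4))
    have zero: "common_zero T \<xi> \<longleftrightarrow>
        poly P \<xi> = 0 \<and> (poly (chebP s) \<xi> = 0 \<or> poly (chebP k) \<xi> = 0)" for \<xi>
      using common_zero_pencil[OF ab(1) A B, of \<xi>] by (simp add: defs(4))
    have no_dbl: "\<not> (poly (chebP s) \<xi> = 0 \<and> poly (chebP k) \<xi> = 0 \<and> poly P \<xi> = 0)" for \<xi>
      using no_common_zero_chebP_triple[of s \<xi> k] nk by (simp only: defs(3)) simp
    have dbl_zero: "\<not> double_common_zero T \<xi>" for \<xi>
      using no_dbl[of \<xi>] by (auto simp: double_common_zero_def zero dbl)
    have c4: "(\<forall>\<xi>. poly (chebP s) \<xi> = 0 \<longrightarrow> double_interception_point T \<xi>) \<and>
        finite {\<xi>. interception_point T \<xi>} \<and> card {\<xi>. interception_point T \<xi>} = k"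
      if "i \<ge> 1" "n = r * (i + 1)" for i
    proof -
      obtain j where "i = Suc j"
        using \<open>i \<ge> 1\<close> by (cases i) auto
      \<comment> \<open>Since \<open>n = r * (j + 2)\<close>, this is
        \<open>k = r * (j + 1) - 1\<close>. The zeros of \<open>chebP s\<close> then lie among the
        \<open>k\<close> distinct zeros of \<open>chebP k\<close>, which make up all interception
        points.\<close>
      then have k: "k = j * Suc s + s"
        using that nk r by simp
      have imp: "poly (chebP k) \<xi> = 0" if "poly (chebP s) \<xi> = 0" for \<xi>
        using chebP_zero_multiple[OF that] k by simp
      then have "{\<xi>. interception_point T \<xi>} = {\<xi>. poly (chebP k) \<xi> = 0}"
        using int_T by auto
      then show ?thesis
        using imp dbl card_zeros_chebP poly_roots_finite[OF chebP_nonzero] by simp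
    qed
    have c7: "common_zero T \<xi>" if "j \<ge> 2" "n = j * r - 1" "poly (chebP s) \<xi> = 0" for j \<xi>
    proof -
      obtain i where "j = Suc i"
        using \<open>j \<ge> 2\<close> by (cases j) auto
      then have "n = i * Suc s + s"
        using that r by simp
      then show ?thesis
        using chebP_zero_multiple[OF that(3), of i] that(3) by (simp add: zero defs(3))
    qed
    \<comment> \<open>For \<open>r = 1\<close> there is no zero, as \<open>chebP 0 = 1\<close>, and
      a claim about all zeros would hold vacuously.\<close>
    have c9: "\<exists>\<xi>. poly (chebP s) \<xi> = 0" if "r \<ge> 2"
      using chebP_zero_exists r that by simp
    \<comment> \<open>The parity of \<open>k\<close> comes from
      \<open>n + r = 2 * s + k + 3\<close>.\<close>
    have "poly P 0 = 0 \<longleftrightarrow> odd n" "poly (chebP s) 0 = 0 \<longleftrightarrow> even r"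
        "poly (chebP k) 0 = 0 \<longleftrightarrow> even (n + r)"
      using r nk by (auto simp: poly_chebP_0_eq_0_iff defs(3) simp del: chebP.simps)
    note origin = int_T dbl zero simple_interception_point_def simple_common_zero_def dbl_zero this
    show ?thesis
      unfolding rs nrk
    proof (intro conjI)
      show "\<forall>S\<in>{T, {A, B}, {A, P}, {B, P}}. {\<xi>. interception_point S \<xi>} =
          {\<xi>. poly (chebP s) \<xi> = 0} \<union> {\<xi>. poly (chebP k) \<xi> = 0}"
        using int by blast
      show "\<forall>i\<ge>1. n = r * (i + 1) \<longrightarrow>
          (\<forall>\<xi>. poly (chebP s) \<xi> = 0 \<longrightarrow> double_interception_point T \<xi>) \<and>
          finite {\<xi>. interception_point T \<xi>} \<and> card {\<xi>. interception_point T \<xi>} = k"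
        using c4 by blast
      show "\<forall>j\<ge>2. n = j * r - 1 \<longrightarrow> (\<forall>\<xi>. poly (chebP s) \<xi> = 0 \<longrightarrow> common_zero T \<xi>)"
        using c7 by blast
      \<comment> \<open>Both sides are false at every point.\<close>
      show "\<forall>\<xi>. double_common_zero T \<xi> \<longleftrightarrow> common_zero {chebP s, P, chebP k} \<xi>"
        using dbl_zero no_dbl by (auto simp: common_zero_def)
      show "r \<ge> 2 \<longrightarrow> \<not> (\<forall>\<xi>. poly (chebP s) \<xi> = 0 \<longrightarrow> double_common_zero T \<xi>)"
        using c9 dbl_zero by blast
    qed (auto simp: origin common_zero_def[of "{_, _}"])
  qed
  show ?thesis
    unfolding Let_def
    by (intro conjI[OF _ conjI] allI impI main[OF _ refl refl refl refl] chebPd_eq_chebP pert)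
qed

end
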